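(* Let $\Phi=(A;\{E_i\}_{i=0}^d;A^*;\{E^*_i\}_{i=0}^d)$ be a Leonard system in $\mathcal{A}$ and let $S$ be the switching element for $\Phi$. Then $S=u_d(A)$, where $u_d=p_d/p_d(\theta_0)$ and $p_d\in\mathbb{K}[\lambda]$ is the unique monic polynomial of degree $d$ such that $p_d(A)E^*_0V=E^*_dV$.
   Context: $\mathbb{K}$ is a field, $d\ge 0$ an integer, $\mathcal{A}$ a $\mathbb{K}$-algebra isomorphic to $\mathrm{Mat}_{d+1}(\mathbb{K})$, $I$ its identity, and $V$ a simple left $\mathcal{A}$-module (so $\dim V=d+1$). The symbol $A^*$ is just a name for a second element (not a conjugate transpose). An element $A\in\mathcal{A}$ is multiplicity-free if it has $d+1$ mutually distinct eigenvalues in $\mathbb{K}$. For an ordering $\{\theta_i\}_{i=0}^d$ of these eigenvalues, the primitive idempotent of $A$ associated with $\theta_i$ is $E_i=\prod_{0\le j\le d,\,j\ne i}\frac{A-\theta_jI}{\theta_i-\theta_j}$. A Leonard system in $\mathcal{A}$ is a sequence $\Phi=(A;\{E_i\}_{i=0}^d;A^*;\{E^*_i\}_{i=0}^d)$ such that $A,A^*\in\mathcal{A}$ are multiplicity-free; $\{E_i\}_{i=0}^d$ (resp. $\{E^*_i\}_{i=0}^d$) is an ordering of the primitive idempotents of $A$ (resp. $A^*$); and for $0\le i,j\le d$ both $E_iA^*E_j$ and $E^*_iAE^*_j$ are zero if $|i-j|>1$ and nonzero if $|i-j|=1$. Let $\theta_i$ (resp. $\theta^*_i$) be the eigenvalue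 of $A$ (resp. $A^*$) associated with $E_i$ (resp. $E^*_i$). Put $\tau_i=(\lambda-\theta_0)(\lambda-\theta_1)\cdots(\lambda-\theta_{i-1})$ and $\eta_i=(\lambda-\theta_d)(\lambda-\theta_{d-1})\cdots(\lambda-\theta_{d-i+1})$ for $0\le i\le d$. The first and second split sequences of $\Phi$ are, for $1\le i\le d$, $\varphi_i=(\theta^*_0-\theta^*_i)\frac{\mathrm{tr}(\tau_i(A)E^*_0)}{\mathrm{tr}(\tau_{i-1}(A)E^*_0)}$ and $\phi_i=(\theta^*_0-\theta^*_i)\frac{\mathrm{tr}(\eta_i(A)E^*_0)}{\mathrm{tr}(\eta_{i-1}(A)E^*_0)}$ (the denominators are known to be nonzero, and all $\varphi_i,\phi_i$ are known to be nonzero). The switching element for $\Phi$ is $S=\sum_{r=0}^d\frac{\phi_d\phi_{d-1}\cdots\phi_{d-r+1}}{\varphi_1\varphi_2\cdots\varphi_r}E_r$. For $0\le i\le d$ there is a unique monic polynomial $p_i\in\mathbb{K}[\lambda]$ of degree $i$ with $p_i(A)E^*_0V=E^*_iV$, and it is known that $p_i(\theta_0)\neq0$. *)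

theory Defs
  imports "Jordan_Normal_Form.Char_Poly"
begin

section \<open>Algebras isomorphic to a full matrix algebra, and their simple modules\<close>

text \<open>An associative unital algebra over a field \<open>'k\<close>; the elements form the whole type \<open>'a\<close>, and
  \<open>scale\<close> is the scalar multiplication.\<close>

locale field_algebra = vector_space scale
  for scale :: "'k::field \<Rightarrow> 'a::ring_1 \<Rightarrow> 'a" +
  assumes scale_mult_left: "scale c x * y = scale c (x * y)"
    and scale_mult_right: "x * scale c y = scale c (x * y)"

text \<open>\<open>h\<close> is an isomorphism of \<open>'k\<close>-algebras onto the algebra of (d+1) by (d+1) matrices.\<close>

locale matrix_algebra_iso = field_algebra scale
  for scale :: "'k::field \<Rightarrow> 'a::ring_1 \<Rightarrow> 'a" +
  fixes d :: nat and h :: "'a \<Rightarrow> 'k mat"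
  assumes h_bij: "bij_betw h UNIV (carrier_mat (d + 1) (d + 1))"
    and h_add: "h (x + y) = h x + h y"
    and h_mult: "h (x * y) = h x * h y"
    and h_one: "h 1 = 1\<^sub>m (d + 1)"
    and h_scale: "h (scale c x) = c \<cdot>\<^sub>m h x"

text \<open>A simple unital left module over a possibly noncommutative ring. (The library's module locale
  is restricted to commutative rings.)\<close>

locale simple_left_module =
  fixes act :: "'a::ring_1 \<Rightarrow> 'v::ab_group_add \<Rightarrow> 'v"
  assumes act_add_right: "act x (v + w) = act x v + act x w"
    and act_add_left: "act (x + y) v = act x v + act y v"
    and act_mult: "act (x * y) v = act x (act y v)"
    and act_one: "act 1 v = v"
    and nonzero: "\<exists>v :: 'v. v \<noteq> 0"
    and simple: "\<lbrakk>0 \<in> W; \<And>v w. \<lbrakk>v \<in> W; w \<in> W\<rbrakk> \<Longrightarrow> v + w \<in> W; \<And>x w. w \<in> W \<Longrightarrow> act x w \<in> W\<rbrakk>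
      \<Longrightarrow> W = {0} \<or> W = UNIV"

text \<open>Eigenvalues and traces of elements of the algebra are those of their images under \<open>h\<close>; by the
  Skolem--Noether theorem they do not depend on the choice of \<open>h\<close>.\<close>

definition eigenvalues :: "('a \<Rightarrow> 'k::field mat) \<Rightarrow> 'a \<Rightarrow> 'k set" where
  "eigenvalues h X = {t. eigenvalue (h X) t}"

definition tr :: "('a \<Rightarrow> 'k::field mat) \<Rightarrow> 'a \<Rightarrow> 'k" where
  "tr h X = (\<Sum>i<dim_row (h X). h X $$ (i, i))"

definition poly_eval :: "('k::field \<Rightarrow> 'a::ring_1 \<Rightarrow> 'a) \<Rightarrow> 'k poly \<Rightarrow> 'a \<Rightarrow> 'a" where
  "poly_eval scale p X = (\<Sum>i\<le>degree p. scale (coeff p i) (X ^ i))"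


section \<open>Leonard systems\<close>

text \<open>Families indexed by \<open>0, \<dots>, d\<close> are functions on \<open>nat\<close>, of which only the values at
  indices at most \<open>d\<close> matter.\<close>

definition multiplicity_free :: "('a \<Rightarrow> 'k::field mat) \<Rightarrow> nat \<Rightarrow> 'a \<Rightarrow> bool" where
  "multiplicity_free h d X \<longleftrightarrow> card (eigenvalues h X) = d + 1"

definition primitive_idempotent ::
  "('k::field \<Rightarrow> 'a::ring_1 \<Rightarrow> 'a) \<Rightarrow> nat \<Rightarrow> 'a \<Rightarrow> (nat \<Rightarrow> 'k) \<Rightarrow> nat \<Rightarrow> 'a" where
  "primitive_idempotent scale d X \<theta> i =
     prod_list (map (\<lambda>j. scale (1 / (\<theta> i - \<theta> j)) (X - scale (\<theta> j) 1)) (filter (\<lambda>j. j \<noteq> i) [0..<d + 1]))"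

text \<open>\<open>\<theta>\<close> is an ordering of the eigenvalues of \<open>X\<close>, and \<open>E\<close> is the corresponding ordering of the
  primitive idempotents of \<open>X\<close>.\<close>

definition associated_orderings ::
  "('k::field \<Rightarrow> 'a::ring_1 \<Rightarrow> 'a) \<Rightarrow> ('a \<Rightarrow> 'k mat) \<Rightarrow> nat \<Rightarrow> 'a \<Rightarrow> (nat \<Rightarrow> 'k) \<Rightarrow> (nat \<Rightarrow> 'a) \<Rightarrow> bool" where
  "associated_orderings scale h d X \<theta> E \<longleftrightarrow>
     bij_betw \<theta> {..d} (eigenvalues h X) \<and>
     (\<forall>i\<le>d. E i = primitive_idempotent scale d X \<theta> i)"

definition leonard_system ::
  "('k::field \<Rightarrow> 'a::ring_1 \<Rightarrow> 'a) \<Rightarrow> ('a \<Rightarrow> 'k mat) \<Rightarrow> nat \<Rightarrow> 'a \<Rightarrow> (nat \<Rightarrow> 'a) \<Rightarrow> 'a \<Rightarrow> (nat \<Rightarrow> 'a) \<Rightarrow> bool" where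
  "leonard_system scale h d A E As Es \<longleftrightarrow>
     multiplicity_free h d A \<and> multiplicity_free h d As \<and>
     (\<exists>\<theta>. associated_orderings scale h d A \<theta> E) \<and>
     (\<exists>\<theta>s. associated_orderings scale h d As \<theta>s Es) \<and>
     (\<forall>i\<le>d. \<forall>j\<le>d.
        (\<bar>int i - int j\<bar> > 1 \<longrightarrow> E i * As * E j = 0 \<and> Es i * A * Es j = 0) \<and>
        (\<bar>int i - int j\<bar> = 1 \<longrightarrow> E i * As * E j \<noteq> 0 \<and> Es i * A * Es j \<noteq> 0))"

definition tau :: "(nat \<Rightarrow> 'k::field) \<Rightarrow> nat \<Rightarrow> 'k poly" where
  "tau \<theta> i = (\<Prod>k<i. [:- \<theta> k, 1:])"

definition eta :: "(nat \<Rightarrow> 'k::field) \<Rightarrow> nat \<Rightarrow> nat \<Rightarrow> 'k poly" where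
  "eta \<theta> d i = (\<Prod>k<i. [:- \<theta> (d - k), 1:])"

text \<open>The split sequences, meaningful for indices \<open>1, \<dots>, d\<close>. Here \<open>Es0\<close> is the idempotent of the
  second element with index 0.\<close>

definition first_split ::
  "('k::field \<Rightarrow> 'a::ring_1 \<Rightarrow> 'a) \<Rightarrow> ('a \<Rightarrow> 'k mat) \<Rightarrow> 'a \<Rightarrow> 'a \<Rightarrow> (nat \<Rightarrow> 'k) \<Rightarrow> (nat \<Rightarrow> 'k) \<Rightarrow> nat \<Rightarrow> 'k" where
  "first_split scale h A Es0 \<theta> \<theta>s i =
     (\<theta>s 0 - \<theta>s i) * (tr h (poly_eval scale (tau \<theta> i) A * Es0)
                     / tr h (poly_eval scale (tau \<theta> (i - 1)) A * Es0))"

definition second_split ::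
  "('k::field \<Rightarrow> 'a::ring_1 \<Rightarrow> 'a) \<Rightarrow> ('a \<Rightarrow> 'k mat) \<Rightarrow> nat \<Rightarrow> 'a \<Rightarrow> 'a \<Rightarrow> (nat \<Rightarrow> 'k) \<Rightarrow> (nat \<Rightarrow> 'k) \<Rightarrow> nat \<Rightarrow> 'k" where
  "second_split scale h d A Es0 \<theta> \<theta>s i =
     (\<theta>s 0 - \<theta>s i) * (tr h (poly_eval scale (eta \<theta> d i) A * Es0)
                     / tr h (poly_eval scale (eta \<theta> d (i - 1)) A * Es0))"

definition switching_element ::
  "('k::field \<Rightarrow> 'a::ring_1 \<Rightarrow> 'a) \<Rightarrow> ('a \<Rightarrow> 'k mat) \<Rightarrow> nat \<Rightarrow> 'a \<Rightarrow> (nat \<Rightarrow> 'a) \<Rightarrow> 'a \<Rightarrow> (nat \<Rightarrow> 'k) \<Rightarrow> (nat \<Rightarrow> 'k) \<Rightarrow> 'a" where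
  "switching_element scale h d A E Es0 \<theta> \<theta>s =
     (\<Sum>r\<le>d. scale ((\<Prod>k<r. second_split scale h d A Es0 \<theta> \<theta>s (d - k))
                   / (\<Prod>k=1..r. first_split scale h A Es0 \<theta> \<theta>s k)) (E r))"

text \<open>\<open>p\<close> is monic of degree \<open>i\<close> and \<open>p(A)\<close> maps the subspace \<open>E\<^sup>*\<^sub>0 V\<close> onto \<open>E\<^sup>*\<^sub>i V\<close>.\<close>

definition is_leonard_poly ::
  "('k::field \<Rightarrow> 'a::ring_1 \<Rightarrow> 'a) \<Rightarrow> ('a \<Rightarrow> 'v \<Rightarrow> 'v) \<Rightarrow> 'a \<Rightarrow> (nat \<Rightarrow> 'a) \<Rightarrow> nat \<Rightarrow> 'k poly \<Rightarrow> bool" where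
  "is_leonard_poly scale act A Es i p \<longleftrightarrow>
     lead_coeff p = 1 \<and> degree p = i \<and>
     act (poly_eval scale p A) ` range (act (Es 0)) = range (act (Es i))"

end

theory Submission
  imports Defs
begin

text \<open>Write \<open>V\<close> for the simple module and fix nonzero vectors \<open>v\<close> in the line \<open>E\<^sup>*\<^sub>0 V\<close> and \<open>x\<close> in the
  line \<open>E\<^sup>*\<^sub>d V\<close>. All \<open>E\<^sub>r v\<close> are nonzero and each \<open>E\<^sub>r V\<close> is a line, so a monic polynomial \<open>p\<close> of
  degree \<open>d\<close> with \<open>p(A) v\<close> proportional to \<open>x\<close> has values \<open>p(\<theta>\<^sub>r)\<close> proportional to the ratios of
  \<open>E\<^sub>r x\<close> to \<open>E\<^sub>r v\<close>. The core of the theorem is therefore that this ratio changes by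
  the factor \<open>\<psi>\<^sub>d\<^sub>-\<^sub>r\<^sub>+\<^sub>1 / \<phi>\<^sub>r\<close> from \<open>r - 1\<close> to \<open>r\<close>, where \<open>\<phi>\<close> is the first split sequence and \<open>\<psi>\<close> the
  second one.

  The source of such factors is the split basis \<open>w\<^sub>i = \<tau>\<^sub>i(A) v\<close>. It is adapted to two opposite
  flags, and comparing both flags gives \<open>(A\<^sup>* - \<theta>\<^sup>*\<^sub>i) w\<^sub>i = \<phi>\<^sub>i w\<^sub>i\<^sub>-\<^sub>1\<close> (lemma \<open>split\<close>); the trace
  formula for \<open>\<phi>\<^sub>i\<close> is what remains after applying \<open>E\<^sup>*\<^sub>0\<close>. Applying \<open>E\<^sub>r\<^sub>-\<^sub>1\<close> to this relation
  instead yields \<open>E\<^sub>r\<^sub>-\<^sub>1 A\<^sup>* E\<^sub>r v\<close> as an explicit multiple of \<open>E\<^sub>r\<^sub>-\<^sub>1 v\<close>, with \<open>\<phi>\<^sub>r\<close> as the only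
  quantity that depends on the starting vector (lemma \<open>superdiagonal\<close>).

  Reversing the order of the \<open>E\<^sup>*\<^sub>i\<close> gives another Leonard system, in which \<open>x\<close> takes the place of
  \<open>v\<close>. Comparing the two instances of the last formula shows that the ratio changes by
  \<open>\<chi>\<^sub>r / \<phi>\<^sub>r\<close>, where \<open>\<chi>\<close> is the first split sequence of the reversed system
  (lemma \<open>E_component_ratio\<close>).

  It remains to see that \<open>\<chi>\<^sub>r = \<psi>\<^sub>d\<^sub>-\<^sub>r\<^sub>+\<^sub>1\<close>. By definition \<open>\<psi>\<close> is the first split sequence of
  the system with the \<open>E\<^sub>i\<close> reversed, so two systems have to be compared that differ by the reversal
  of both orders. The split basis expresses the trace of \<open>A E\<^sup>*\<^sub>i\<close> through two neighbouring members
  of the first split sequence (lemma \<open>trace_A_Es\<close>). This trace is the same in both systems up to the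
  reversal of the index, and the resulting recurrence forces equality (lemma
  \<open>second_split_reverse\<close>).\<close>

section \<open>Simple modules over a prime algebra\<close>

text \<open>Of the matrix algebra itself, the arguments on the module only use that it is a prime ring and
  that primitive idempotents cut out one-dimensional corners; the latter enters with the idempotents
  below.\<close>

locale algebra_module = field_algebra scale + simple_left_module act
  for scale :: "'k::field \<Rightarrow> 'a::ring_1 \<Rightarrow> 'a" and act :: "'a \<Rightarrow> 'v::ab_group_add \<Rightarrow> 'v" +
  assumes prime: "(X :: 'a) \<noteq> 0 \<Longrightarrow> Z \<noteq> 0 \<Longrightarrow> \<exists>Y. X * Y * Z \<noteq> 0"
begin

definition smul :: "'k \<Rightarrow> 'v \<Rightarrow> 'v" where
  "smul c v = act (scale c 1) v"

lemma act_scale: "act (scale c X) v = smul c (act X v)"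
  using scale_mult_left[of c 1 X] by (simp add: smul_def flip: act_mult)

lemma act_smul: "act X (smul c v) = smul c (act X v)"
  using scale_mult_right[of X c 1] by (simp add: smul_def scale_mult_left flip: act_mult)

lemma act_zero_right [simp]: "act X 0 = 0"
  using act_add_right[of X 0 0] by simp

lemma act_zero_left [simp]: "act 0 v = 0"
  using act_add_left[of 0 0 v] by simp

lemma act_diff_right: "act X (v - w) = act X v - act X w"
  using act_add_right[of X "v - w" w] by simp

lemma act_diff_left: "act (X - Y) v = act X v - act Y v"
  using act_add_left[of "X - Y" Y v] by simp

lemma act_sum_right: "act X (sum f I) = (\<Sum>i\<in>I. act X (f i))"
  by (induction I rule: infinite_finite_induct) (auto simp: act_add_right)

lemma act_sum_left: "act (sum f I) v = (\<Sum>i\<in>I. act (f i) v)"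
  by (induction I rule: infinite_finite_induct) (auto simp: act_add_left)

sublocale V: vector_space smul
proof
  show "smul a (x + y) = smul a x + smul a y" for a x y
    by (simp add: smul_def act_add_right)
  show "smul (a + b) x = smul a x + smul b x" for a b x
    by (simp add: smul_def scale_left_distrib act_add_left)
  show "smul a (smul b x) = smul (a * b) x" for a b x
    by (metis act_scale smul_def scale_scale)
  show "smul 1 x = x" for x
    by (simp add: smul_def act_one)
qed

lemma transitive:
  assumes "v \<noteq> 0" shows "\<exists>Y. w = act Y v"
proof -
  let ?W = "range (\<lambda>Y. act Y v)"
  have "?W = {0} \<or> ?W = UNIV"
  proof (rule simple)
    show "0 \<in> ?W" by (metis act_zero_left rangeI)
    show "x + y \<in> ?W" if "x \<in> ?W" "y \<in> ?W" for x y
      using that by (auto simp flip: act_add_left)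
    show "act X x \<in> ?W" if "x \<in> ?W" for X x
      using that by (auto simp flip: act_mult)
  qed
  moreover have "v \<in> ?W" by (metis act_one rangeI)
  ultimately show ?thesis using assms by blast
qed

end

section \<open>Primitive idempotents acting on the module\<close>

text \<open>\<open>T\<close> is the trace. The last assumption says that \<open>E i\<close> has rank one and records the scalar by
  which the corner element \<open>E i * Y * E i\<close> acts.\<close>

locale module_resolution = algebra_module scale act
  for scale :: "'k::field \<Rightarrow> 'a::ring_1 \<Rightarrow> 'a" and act :: "'a \<Rightarrow> 'v::ab_group_add \<Rightarrow> 'v" +
  fixes T :: "'a \<Rightarrow> 'k" and d :: nat and X :: 'a and \<theta> :: "nat \<Rightarrow> 'k" and E :: "nat \<Rightarrow> 'a"
  assumes inj: "inj_on \<theta> {..d}"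
    and E_nonzero: "i \<le> d \<Longrightarrow> E i \<noteq> 0"
    and orthogonal: "i \<le> d \<Longrightarrow> j \<le> d \<Longrightarrow> E i * E j = (if i = j then E i else 0)"
    and complete: "(\<Sum>i\<le>d. E i) = 1"
    and spectral: "X = (\<Sum>i\<le>d. scale (\<theta> i) (E i))"
    and rank_one: "i \<le> d \<Longrightarrow> E i * Y * E i = scale (T (Y * E i)) (E i)"
begin

lemma distinct: "i \<le> d \<Longrightarrow> j \<le> d \<Longrightarrow> \<theta> i = \<theta> j \<longleftrightarrow> i = j"
  using inj_on_eq_iff[OF inj] by simp

lemma act_E_E: "i \<le> d \<Longrightarrow> j \<le> d \<Longrightarrow> act (E i) (act (E j) v) = (if i = j then act (E i) v else 0)"
  by (simp add: orthogonal flip: act_mult)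

lemma decompose: "v = (\<Sum>i\<le>d. act (E i) v)"
proof -
  have "v = act (\<Sum>i\<le>d. E i) v" by (simp only: complete act_one)
  then show ?thesis by (simp only: act_sum_left)
qed

lemma eq_by_components:
  assumes "\<And>i. i \<le> d \<Longrightarrow> act (E i) v = act (E i) w" shows "v = w"
proof -
  have "(\<Sum>i\<le>d. act (E i) v) = (\<Sum>i\<le>d. act (E i) w)" by (rule sum.cong) (simp_all add: assms)
  then show ?thesis by (simp only: decompose[symmetric])
qed

lemma eq_0_by_components: "(\<And>i. i \<le> d \<Longrightarrow> act (E i) v = 0) \<Longrightarrow> v = 0"
  by (rule eq_by_components) simp

lemma expand: "act (E r) (act Y v) = (\<Sum>j\<le>d. act (E r * Y * E j) v)"
proof -
  have "act (E r) (act Y v) = act (E r) (act Y (\<Sum>j\<le>d. act (E j) v))" by (simp only: decompose[symmetric])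
  then show ?thesis by (simp only: act_mult act_sum_right)
qed

lemma act_E_X: assumes "i \<le> d" shows "act (E i) (act X v) = smul (\<theta> i) (act (E i) v)"
proof -
  have "E i * X = (\<Sum>j\<le>d. if j = i then scale (\<theta> i) (E i) else 0)"
    unfolding spectral sum_distrib_left
    by (rule sum.cong) (auto simp: scale_mult_right orthogonal assms)
  also have "\<dots> = scale (\<theta> i) (E i)" using assms by simp
  finally show ?thesis by (simp add: act_scale flip: act_mult)
qed

lemma act_E_X_pow: "i \<le> d \<Longrightarrow> act (E i) (act (X ^ n) v) = smul (\<theta> i ^ n) (act (E i) v)"
  by (induction n arbitrary: v) (simp_all add: act_one act_mult act_E_X)

lemma act_E_poly:
  assumes "i \<le> d"
  shows "act (E i) (act (poly_eval scale p X) v) = smul (poly p (\<theta> i)) (act (E i) v)"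
  by (simp add: poly_eval_def act_sum_left act_sum_right act_scale act_smul act_E_X_pow[OF assms]
      poly_altdef V.scale_sum_left)

text \<open>Each \<open>E i V\<close> is a line: by simplicity any vector is \<open>Y\<close> applied to a given nonzero vector of
  \<open>E i V\<close>, and the corner \<open>E i * Y * E i\<close> consists of multiples of \<open>E i\<close>.\<close>

lemma line:
  assumes i: "i \<le> d" and v: "act (E i) v \<noteq> 0"
  shows "\<exists>c. act (E i) w = smul c (act (E i) v)"
proof -
  obtain Y where "w = act Y (act (E i) v)" using transitive[OF v] by blast
  then have "act (E i) w = act (E i * Y * E i) v"
    by (simp add: act_mult)
  also have "\<dots> = smul (T (Y * E i)) (act (E i) v)"
    by (simp add: rank_one i act_scale)
  finally show ?thesis by blast
qed

text \<open>If \<open>Z * E i\<close> is nonzero, primeness yields elements carrying it to a nonzero element of every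
  corner \<open>E k * _ * E k\<close>, that is, to a nonzero multiple of \<open>E k\<close>. If \<open>Z * E i\<close> acted as zero, then
  so would every \<open>E k\<close>, and hence their sum 1.\<close>

lemma faithful_corner:
  assumes i: "i \<le> d" and v: "\<And>v. act (Z * E i) v = 0" shows "Z * E i = 0"
proof (rule ccontr)
  assume nz: "Z * E i \<noteq> 0"
  have "act (E k) w = 0" if k: "k \<le> d" for k w
  proof -
    obtain Y where Y: "E k * Y * (Z * E i) \<noteq> 0" using prime[OF E_nonzero[OF k] nz] by blast
    obtain U where U: "(E k * Y * (Z * E i)) * U * E k \<noteq> 0" using prime[OF Y E_nonzero[OF k]] by blast
    define c where "c = T (Y * Z * E i * U * E k)"
    have c: "(E k * Y * (Z * E i)) * U * E k = scale c (E k)"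
      using rank_one[OF k, of "Y * Z * E i * U"] by (simp add: mult.assoc c_def)
    then have "c \<noteq> 0" using U by auto
    have "smul c (act (E k) w) = act (E k * Y) (act (Z * E i) (act (U * E k) w))"
      unfolding act_scale[symmetric] c[symmetric] by (simp add: act_mult)
    also have "\<dots> = 0" by (simp add: v)
    finally show ?thesis using \<open>c \<noteq> 0\<close> by simp
  qed
  then have "w = 0" for w :: 'v by (rule eq_0_by_components)
  then show False using nonzero by blast
qed

text \<open>A linear map that does not vanish on a line is injective on it.\<close>

lemma corner_injective:
  assumes "i \<le> d" "Z * E i \<noteq> 0" "act (E i) v \<noteq> 0"
  shows "act (Z * E i) v \<noteq> 0"
proof
  assume 0: "act (Z * E i) v = 0"
  have "act (Z * E i) w = 0" for w
  proof -
    obtain c where "act (E i) w = smul c (act (E i) v)" using line[OF assms(1,3)] by blast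
    then have "act (Z * E i) w = smul c (act (Z * E i) v)" by (simp add: act_mult act_smul)
    then show ?thesis using 0 by simp
  qed
  then have "Z * E i = 0" by (rule faithful_corner[OF assms(1)])
  then show False using assms(2) by simp
qed

lemma faithful:
  assumes "\<And>v. act Y v = act Z v" shows "Y = Z"
proof -
  have "(Y - Z) * E i = 0" if "i \<le> d" for i
    using that by (rule faithful_corner) (simp add: act_mult act_diff_left assms)
  then have "(Y - Z) * (\<Sum>i\<le>d. E i) = 0" by (simp add: sum_distrib_left)
  then show ?thesis by (simp add: complete)
qed

lemma range_nonzero:
  assumes "i \<le> d" shows "\<exists>v. v \<noteq> 0 \<and> act (E i) v = v"
proof -
  obtain v where "act (1 * E i) v \<noteq> 0"
    using faithful_corner[OF assms, of 1] E_nonzero[OF assms] by (metis mult_1)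
  moreover have "act (E i) (act (E i) v) = act (E i) v"
    using assms by (simp add: act_E_E)
  ultimately show ?thesis by (metis mult_1)
qed

lemma reversed: "module_resolution scale act T d X (\<lambda>i. \<theta> (d - i)) (\<lambda>i. E (d - i))"
proof
  show "inj_on (\<lambda>i. \<theta> (d - i)) {..d}"
    by (rule inj_onI) (use inj in \<open>force dest: inj_onD\<close>)
  show "(\<Sum>i\<le>d. E (d - i)) = 1"
    using complete sum.nat_diff_reindex[of E "Suc d"]
    by (simp only: lessThan_Suc_atMost diff_Suc_Suc)
  show "X = (\<Sum>i\<le>d. scale (\<theta> (d - i)) (E (d - i)))"
    using spectral sum.nat_diff_reindex[of "\<lambda>i. scale (\<theta> i) (E i)" "Suc d"]
    by (simp only: lessThan_Suc_atMost diff_Suc_Suc)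
next
  fix i assume "i \<le> d"
  show "E (d - i) \<noteq> 0" by (rule E_nonzero) simp
  show "E (d - i) * Y * E (d - i) = scale (T (Y * E (d - i))) (E (d - i))" for Y
    by (rule rank_one) simp
  fix j assume "j \<le> d"
  then have "d - i = d - j \<longleftrightarrow> i = j" using \<open>i \<le> d\<close> by linarith
  then show "E (d - i) * E (d - j) = (if i = j then E (d - i) else 0)"
    using orthogonal[of "d - i" "d - j"] by simp
qed

end

section \<open>Tridiagonal elements\<close>

locale tridiagonal_resolution = module_resolution scale act T d X \<theta> E
  for scale :: "'k::field \<Rightarrow> 'a::ring_1 \<Rightarrow> 'a" and act :: "'a \<Rightarrow> 'v::ab_group_add \<Rightarrow> 'v"
    and T :: "'a \<Rightarrow> 'k" and d :: nat and X :: 'a and \<theta> :: "nat \<Rightarrow> 'k" and E :: "nat \<Rightarrow> 'a" +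
  fixes Y :: 'a
  assumes far: "i \<le> d \<Longrightarrow> j \<le> d \<Longrightarrow> \<bar>int i - int j\<bar> > 1 \<Longrightarrow> E i * Y * E j = 0"
    and near: "i \<le> d \<Longrightarrow> j \<le> d \<Longrightarrow> \<bar>int i - int j\<bar> = 1 \<Longrightarrow> E i * Y * E j \<noteq> 0"
begin

lemma tridiagonal_reversed: "tridiagonal_resolution scale act T d X (\<lambda>i. \<theta> (d - i)) (\<lambda>i. E (d - i)) Y"
proof (intro tridiagonal_resolution.intro reversed tridiagonal_resolution_axioms.intro)
  fix i j assume ij: "i \<le> d" "j \<le> d"
  have "\<bar>int (d - i) - int (d - j)\<bar> = \<bar>int i - int j\<bar>" using ij by linarith
  then show "\<bar>int i - int j\<bar> > 1 \<Longrightarrow> E (d - i) * Y * E (d - j) = 0"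
    "\<bar>int i - int j\<bar> = 1 \<Longrightarrow> E (d - i) * Y * E (d - j) \<noteq> 0"
    by (simp_all add: far near)
qed

text \<open>The next four lemmas describe how \<open>Y\<close> moves the two flags attached to the ordering: it extends
  the support of a vector by at most one index at either end, and the new extreme component comes
  from the old extreme component alone.\<close>

lemma raise_far:
  assumes "\<And>k. i < k \<Longrightarrow> k \<le> d \<Longrightarrow> act (E k) y = 0" "Suc i < j" "j \<le> d"
  shows "act (E j) (act Y y) = 0"
  unfolding expand
proof (intro sum.neutral ballI)
  fix k assume "k \<in> {..d}"
  then show "act (E j * Y * E k) y = 0"
    using assms far[of j k] by (cases "k \<le> i") (auto simp: act_mult)
qed

lemma raise:
  assumes "\<And>k. i < k \<Longrightarrow> k \<le> d \<Longrightarrow> act (E k) y = 0" "Suc i \<le> d"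
  shows "act (E (Suc i)) (act Y y) = act (E (Suc i) * Y * E i) y"
proof -
  have "(\<Sum>k\<le>d. act (E (Suc i) * Y * E k) y) = (\<Sum>k\<in>{i}. act (E (Suc i) * Y * E k) y)"
  proof (rule sum.mono_neutral_right; safe?)
    fix k assume "k \<le> d" "act (E (Suc i) * Y * E k) y \<noteq> 0"
    then show "k = i"
      using assms far[of "Suc i" k] by (cases "k < i"; cases "i < k") (auto simp: act_mult)
  qed (use assms in auto)
  then show ?thesis unfolding expand by simp
qed

lemma lower_far:
  assumes "\<And>k. k < i \<Longrightarrow> act (E k) y = 0" "Suc j < i" "i \<le> d"
  shows "act (E j) (act Y y) = 0"
  unfolding expand
proof (intro sum.neutral ballI)
  fix k assume "k \<in> {..d}"
  then show "act (E j * Y * E k) y = 0"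
    using assms far[of j k] by (cases "k < i") (auto simp: act_mult)
qed

lemma lower:
  assumes "\<And>k. k \<le> i \<Longrightarrow> act (E k) y = 0" "Suc i \<le> d"
  shows "act (E i) (act Y y) = act (E i * Y * E (Suc i)) y"
proof -
  have "(\<Sum>k\<le>d. act (E i * Y * E k) y) = (\<Sum>k\<in>{Suc i}. act (E i * Y * E k) y)"
  proof (rule sum.mono_neutral_right; safe?)
    fix k assume "k \<le> d" "act (E i * Y * E k) y \<noteq> 0"
    then show "k = Suc i"
      using assms far[of i k] by (cases "k \<le> i"; cases "Suc i < k") (auto simp: act_mult)
  qed (use assms in auto)
  then show ?thesis unfolding expand by simp
qed

text \<open>The eigenvector equation is a three-term recurrence with nonzero off-diagonal coefficients, so an
  eigenvector with vanishing first component vanishes.\<close>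

lemma eigenvector_component_0:
  assumes eig: "act Y y = smul t y" and "y \<noteq> 0"
  shows "act (E 0) y \<noteq> 0"
proof
  assume 0: "act (E 0) y = 0"
  have "\<forall>k\<le>r. act (E k) y = 0" if "r \<le> d" for r
    using that
  proof (induction r)
    case (Suc r)
    then have IH: "\<And>k. k \<le> r \<Longrightarrow> act (E k) y = 0" by simp
    have "act (E r * Y * E (Suc r)) y = 0"
      using lower[OF IH Suc.prems] IH[of r] by (simp add: eig act_smul)
    then have "act (E (Suc r)) y = 0"
      using corner_injective[of "Suc r" "E r * Y" y] near[of r "Suc r"] Suc.prems by auto
    then show ?case using IH le_Suc_eq by auto
  qed (use 0 in simp)
  then show False using eq_0_by_components[of y] \<open>y \<noteq> 0\<close> by blast
qed

end

section \<open>The split basis of a Leonard system\<close>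

text \<open>The two halves of a Leonard system: \<open>A\<close> prefixes facts on the idempotents of \<open>A\<close>, on which \<open>As\<close>
  is tridiagonal, and \<open>D\<close> (for dual) prefixes facts on the idempotents of \<open>As\<close>.\<close>

locale leonard_module = algebra_module scale act +
  A: tridiagonal_resolution scale act "tr h" d A \<theta> E As +
  D: tridiagonal_resolution scale act "tr h" d As \<theta>s Es A
  for scale :: "'k::field \<Rightarrow> 'a::ring_1 \<Rightarrow> 'a" and act :: "'a \<Rightarrow> 'v::ab_group_add \<Rightarrow> 'v"
    and h :: "'a \<Rightarrow> 'k mat" and d :: nat and A :: 'a and \<theta> :: "nat \<Rightarrow> 'k" and E :: "nat \<Rightarrow> 'a"
    and As :: 'a and \<theta>s :: "nat \<Rightarrow> 'k" and Es :: "nat \<Rightarrow> 'a"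
begin

lemma reverse_E: "leonard_module scale act h d A (\<lambda>i. \<theta> (d - i)) (\<lambda>i. E (d - i)) As \<theta>s Es"
  by (intro leonard_module.intro A.tridiagonal_reversed D.tridiagonal_resolution_axioms
      algebra_module_axioms)

lemma reverse_Es: "leonard_module scale act h d A \<theta> E As (\<lambda>i. \<theta>s (d - i)) (\<lambda>i. Es (d - i))"
  by (intro leonard_module.intro D.tridiagonal_reversed A.tridiagonal_resolution_axioms
      algebra_module_axioms)

abbreviation "ev p \<equiv> act (poly_eval scale p A)"

lemma ev_mult: "ev (p * q) v = ev p (ev q v)"
  by (rule A.eq_by_components) (simp add: A.act_E_poly)

lemma ev_add: "ev (p + q) v = ev p v + ev q v"
  by (rule A.eq_by_components) (simp add: A.act_E_poly act_add_right V.scale_left_distrib)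

lemma ev_diff: "ev (p - q) v = ev p v - ev q v"
  by (rule A.eq_by_components) (simp add: A.act_E_poly act_diff_right V.scale_left_diff_distrib)

lemma ev_smult: "ev (Polynomial.smult c p) v = smul c (ev p v)"
  by (rule A.eq_by_components) (simp add: A.act_E_poly act_smul)

lemma ev_linear: "ev [:- c, 1:] v = act A v - smul c v"
  by (rule A.eq_by_components)
    (simp add: A.act_E_poly act_diff_right act_smul A.act_E_X V.scale_left_diff_distrib)

lemma poly_tau_eq_0: "j < i \<Longrightarrow> poly (tau \<theta> i) (\<theta> j) = 0"
  by (auto simp: tau_def poly_prod)

lemma poly_tau_neq_0: "i \<le> d \<Longrightarrow> poly (tau \<theta> i) (\<theta> i) \<noteq> 0"
  by (auto simp: tau_def poly_prod A.distinct)

lemma degree_tau: "degree (tau \<theta> i) = i"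
  by (simp add: tau_def degree_prod_eq_sum_degree)

lemma lead_coeff_tau: "lead_coeff (tau \<theta> i) = 1"
  unfolding tau_def lead_coeff_prod by simp

context
  fixes v :: 'v
  assumes v0: "v \<noteq> 0" and Es_v: "act (Es 0) v = v"
begin

abbreviation "w i \<equiv> ev (tau \<theta> i) v"

lemma A_w: "act A (w i) = smul (\<theta> i) (w i) + w (Suc i)"
proof -
  have "tau \<theta> (Suc i) = [:- \<theta> i, 1:] * tau \<theta> i" by (simp add: tau_def mult.commute)
  then show ?thesis by (simp only: ev_mult ev_linear) simp
qed

lemma w_0: "w 0 = v"
  by (rule A.eq_by_components) (simp add: A.act_E_poly tau_def)

lemma E_w: "j < i \<Longrightarrow> j \<le> d \<Longrightarrow> act (E j) (w i) = 0"
  by (simp add: A.act_E_poly poly_tau_eq_0)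

lemma Es_w: "i < j \<Longrightarrow> j \<le> d \<Longrightarrow> act (Es j) (w i) = 0"
proof (induction i arbitrary: j)
  case 0
  then show ?case using D.act_E_E[of j 0 v] Es_v by (simp add: w_0)
next
  case (Suc i)
  have "w (Suc i) = act A (w i) - smul (\<theta> i) (w i)" by (simp add: A_w)
  then show ?case
    using D.raise_far[of i "w i" j] Suc by (simp add: act_diff_right act_smul)
qed

lemma Es_w_Suc: "Suc i \<le> d \<Longrightarrow> act (Es (Suc i)) (w (Suc i)) = act (Es (Suc i)) (act A (w i))"
  by (simp add: A_w act_add_right act_smul Es_w)

lemma Es_w_diag: "i \<le> d \<Longrightarrow> act (Es i) (w i) \<noteq> 0"
proof (induction i)
  case 0
  then show ?case using v0 Es_v by (simp add: w_0)
next
  case (Suc i)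
  have "act (Es (Suc i)) (w (Suc i)) = act (Es (Suc i) * A * Es i) (w i)"
    using D.raise[of i "w i"] Es_w Suc.prems by (simp add: Es_w_Suc)
  then show ?case
    using D.corner_injective[of i "Es (Suc i) * A" "w i"] D.near[of "Suc i" i] Suc by simp
qed

text \<open>The vectors \<open>w 0, \<dots>, w (m - 1)\<close> are triangular with nonzero diagonal with respect to the lines
  \<open>Es i V\<close>, so they span the sum of the first \<open>m\<close> lines. For \<open>m = d + 1\<close> this says that \<open>v\<close> is a cyclic
  vector of \<open>A\<close>.\<close>

lemma cyclic:
  assumes "m \<le> Suc d" "\<And>j. m \<le> j \<Longrightarrow> j \<le> d \<Longrightarrow> act (Es j) y = 0"
  shows "\<exists>p. (p = 0 \<or> degree p < m) \<and> y = ev p v"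
  using assms
proof (induction m arbitrary: y)
  case 0
  have "y = 0" by (rule D.eq_0_by_components) (simp add: 0)
  moreover have "ev 0 v = 0" using ev_diff[of 0 0 v] by simp
  ultimately show ?case by (intro exI[of _ 0]) simp
next
  case (Suc m)
  obtain c where c: "act (Es m) y = smul c (act (Es m) (w m))"
    using D.line[OF _ Es_w_diag, of m] Suc.prems by auto
  have "\<exists>p. (p = 0 \<or> degree p < m) \<and> y - smul c (w m) = ev p v"
  proof (rule Suc.IH)
    fix j assume "m \<le> j" "j \<le> d"
    then show "act (Es j) (y - smul c (w m)) = 0"
      using c Suc.prems Es_w[of m j] by (cases "j = m") (auto simp: act_diff_right act_smul)
  qed (use Suc.prems in simp)
  then obtain p where p: "p = 0 \<or> degree p < m" "y - smul c (w m) = ev p v" by blast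
  have "y = ev (p + Polynomial.smult c (tau \<theta> m)) v"
    using p(2) by (simp add: ev_add ev_smult algebra_simps)
  moreover have "degree (p + Polynomial.smult c (tau \<theta> m)) < Suc m"
    using p(1) degree_tau[of m] degree_smult_le[of c "tau \<theta> m"]
    by (intro le_less_trans[OF degree_add_le_max]) auto
  ultimately show ?case by blast
qed

text \<open>If \<open>E k v = 0\<close>, then \<open>E k\<close> kills everything generated from \<open>v\<close> by \<open>A\<close>, which is all of \<open>V\<close>.\<close>

lemma E_v: assumes "k \<le> d" shows "act (E k) v \<noteq> 0"
proof
  assume 0: "act (E k) v = 0"
  obtain y where y: "y \<noteq> 0" "act (E k) y = y" using A.range_nonzero[OF assms] by blast
  obtain p where "y = ev p v" using cyclic[of "Suc d" y] by auto
  then show False using y 0 by (simp add: A.act_E_poly assms)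
qed

text \<open>The sum of the first \<open>k\<close> lines \<open>Es j V\<close> meets the sum of the \<open>E j V\<close> with \<open>j \<ge> k\<close> trivially:
  a vector of the former is \<open>p(A) v\<close> with \<open>p\<close> of degree below \<open>k\<close>, and belonging to the latter makes
  \<open>\<theta> 0, \<dots>, \<theta> (k - 1)\<close> roots of \<open>p\<close>.\<close>

lemma opposite_flags:
  assumes "k \<le> Suc d" "\<And>j. k \<le> j \<Longrightarrow> j \<le> d \<Longrightarrow> act (Es j) y = 0"
    "\<And>j. j < k \<Longrightarrow> act (E j) y = 0"
  shows "y = 0"
proof -
  obtain p where p: "p = 0 \<or> degree p < k" "y = ev p v" using cyclic assms by blast
  have roots: "poly p (\<theta> j) = 0" if "j < k" for j
    using assms(3)[OF that] that assms(1) E_v[of j] by (simp add: p(2) A.act_E_poly)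
  have "p = 0"
  proof (rule ccontr)
    assume p0: "p \<noteq> 0"
    have "card (\<theta> ` {..<k}) = k"
      using assms(1) by (intro trans[OF card_image]) (auto intro: inj_on_subset[OF A.inj])
    moreover have "card (\<theta> ` {..<k}) \<le> card {t. poly p t = 0}"
      using roots by (intro card_mono poly_roots_finite[OF p0]) auto
    moreover have "card {t. poly p t = 0} \<le> degree p" by (rule card_poly_roots_bound[OF p0])
    ultimately show False using p(1) p0 by simp
  qed
  then show ?thesis using p(2) ev_diff[of 0 0 v] by simp
qed

text \<open>The vector \<open>(As - \<theta>s (i + 1)) w (i + 1)\<close> lies in the first \<open>i + 1\<close> lines \<open>Es j V\<close> and, as \<open>As\<close>
  is tridiagonal, in the sum of the \<open>E j V\<close> with \<open>j \<ge> i\<close>. So does \<open>w i\<close>; subtracting the multiple of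
  \<open>w i\<close> with the same \<open>Es i\<close>-component leaves a vector in two opposite flags.\<close>

lemma As_w_ex:
  assumes i: "Suc i \<le> d"
  shows "\<exists>c. act As (w (Suc i)) = smul (\<theta>s (Suc i)) (w (Suc i)) + smul c (w i)"
proof -
  define y where "y = act As (w (Suc i)) - smul (\<theta>s (Suc i)) (w (Suc i))"
  obtain c where c: "act (Es i) y = smul c (act (Es i) (w i))"
    using D.line[OF _ Es_w_diag, of i] i by auto
  have "y - smul c (w i) = 0"
  proof (rule opposite_flags[of i])
    fix j assume "i \<le> j" "j \<le> d"
    then consider "j = i" | "j = Suc i" | "Suc i < j" by linarith
    then show "act (Es j) (y - smul c (w i)) = 0"
    proof cases
      case 1
      then show ?thesis using c by (simp add: act_diff_right act_smul)
    qed (use i \<open>j \<le> d\<close> in \<open>auto simp: act_diff_right act_smul Es_w y_def D.act_E_X\<close>)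
  next
    fix j assume "j < i"
    then show "act (E j) (y - smul c (w i)) = 0"
      using i A.lower_far[of "Suc i" "w (Suc i)" j]
      by (simp add: y_def act_diff_right act_smul E_w)
  qed (use i in simp)
  then show ?thesis unfolding y_def by (intro exI[of _ c]) (simp add: algebra_simps)
qed

abbreviation "\<phi> \<equiv> first_split scale h A (Es 0) \<theta> \<theta>s"
abbreviation "t i \<equiv> tr h (poly_eval scale (tau \<theta> i) A * Es 0)"

lemma Es_0_w: "act (Es 0) (w i) = smul (t i) v"
proof -
  have "act (Es 0) (w i) = act (Es 0 * poly_eval scale (tau \<theta> i) A * Es 0) v"
    by (simp add: act_mult Es_v)
  then show ?thesis by (simp add: D.rank_one act_scale Es_v)
qed

text \<open>The component along \<open>Es 0 V\<close> of the relation in \<open>As_w_ex\<close>. Its coefficient cannot vanish, since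
  otherwise \<open>w (i + 1)\<close> would be an eigenvector of \<open>As\<close> without a component in \<open>E 0 V\<close>.\<close>

lemma t_step:
  assumes i: "Suc i \<le> d"
    and c: "act As (w (Suc i)) = smul (\<theta>s (Suc i)) (w (Suc i)) + smul c (w i)"
  shows "(\<theta>s 0 - \<theta>s (Suc i)) * t (Suc i) = c * t i" "c \<noteq> 0"
proof -
  have "smul (\<theta>s 0 * t (Suc i)) v = smul (\<theta>s (Suc i) * t (Suc i) + c * t i) v"
    using arg_cong[OF c, of "act (Es 0)"]
    by (simp add: D.act_E_X act_add_right act_smul Es_0_w V.scale_left_distrib)
  then have "\<theta>s 0 * t (Suc i) = \<theta>s (Suc i) * t (Suc i) + c * t i"
    using v0 by (simp only: V.scale_cancel_right) simp
  then show "(\<theta>s 0 - \<theta>s (Suc i)) * t (Suc i) = c * t i"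
    by (simp add: algebra_simps)
  show "c \<noteq> 0"
  proof
    assume "c = 0"
    moreover have "w (Suc i) \<noteq> 0" using Es_w_diag[OF i] by auto
    ultimately have "act (E 0) (w (Suc i)) \<noteq> 0" using A.eigenvector_component_0[of "w (Suc i)"] c by auto
    then show False using E_w[of 0 "Suc i"] by simp
  qed
qed

lemma t_nonzero: "i \<le> d \<Longrightarrow> t i \<noteq> 0"
proof (induction i)
  case 0
  have "smul (t 0) v = v" using Es_0_w[of 0] by (simp add: w_0 Es_v)
  then show ?case using v0 by auto
next
  case (Suc i)
  then obtain c where "act As (w (Suc i)) = smul (\<theta>s (Suc i)) (w (Suc i)) + smul c (w i)"
    using As_w_ex by blast
  from t_step[OF Suc.prems this] Suc show ?case by auto
qed

text \<open>The coefficient is therefore the quotient of traces that defines the first split sequence.\<close>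

lemma split:
  assumes i: "Suc i \<le> d"
  shows "act As (w (Suc i)) = smul (\<theta>s (Suc i)) (w (Suc i)) + smul (\<phi> (Suc i)) (w i)"
    and "\<phi> (Suc i) \<noteq> 0"
proof -
  obtain c where c: "act As (w (Suc i)) = smul (\<theta>s (Suc i)) (w (Suc i)) + smul c (w i)"
    using As_w_ex[OF i] by blast
  have "\<phi> (Suc i) = c"
    using t_step(1)[OF i c] t_nonzero[of i] i by (simp add: first_split_def divide_simps)
  then show "act As (w (Suc i)) = smul (\<theta>s (Suc i)) (w (Suc i)) + smul (\<phi> (Suc i)) (w i)"
    and "\<phi> (Suc i) \<noteq> 0" using c t_step(2)[OF i c] by auto
qed

text \<open>The component along \<open>E r V\<close> of the relation in \<open>split\<close>. The factors \<open>poly (tau \<theta> r) (\<theta> r)\<close> do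
  not depend on the order of the \<open>Es i\<close>, and this makes a comparison with the reversed system
  possible.\<close>

lemma superdiagonal:
  assumes r: "Suc r \<le> d"
  shows "smul (poly (tau \<theta> (Suc r)) (\<theta> (Suc r))) (act (E r * As * E (Suc r)) v)
     = smul (\<phi> (Suc r) * poly (tau \<theta> r) (\<theta> r)) (act (E r) v)"
proof -
  have "act (E r) (act As (w (Suc r))) = act (E r * As * E (Suc r)) (w (Suc r))"
    using r by (intro A.lower) (auto simp: E_w)
  also have "\<dots> = smul (poly (tau \<theta> (Suc r)) (\<theta> (Suc r))) (act (E r * As * E (Suc r)) v)"
    using r by (simp add: act_mult A.act_E_poly act_smul)
  finally have "smul (poly (tau \<theta> (Suc r)) (\<theta> (Suc r))) (act (E r * As * E (Suc r)) v)
      = act (E r) (act As (w (Suc r)))" ..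
  also have "\<dots> = smul (\<phi> (Suc r) * poly (tau \<theta> r) (\<theta> r)) (act (E r) v)"
    unfolding split(1)[OF r] using r
    by (simp add: act_add_right act_smul A.act_E_poly poly_tau_eq_0)
  finally show ?thesis .
qed

text \<open>The relation in \<open>split\<close>, read off in \<open>Es i V\<close>, determines the second highest component of
  \<open>w (i + 1)\<close>.\<close>

lemma Es_w_sub:
  assumes i: "Suc i \<le> d"
  shows "act (Es i) (w (Suc i)) = smul (\<phi> (Suc i) / (\<theta>s i - \<theta>s (Suc i))) (act (Es i) (w i))"
proof -
  have ne: "\<theta>s i \<noteq> \<theta>s (Suc i)" using i by (simp add: D.distinct)
  have "smul (\<theta>s i) (act (Es i) (w (Suc i)))
      = smul (\<theta>s (Suc i)) (act (Es i) (w (Suc i))) + smul (\<phi> (Suc i)) (act (Es i) (w i))"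
    using arg_cong[OF split(1)[OF i], of "act (Es i)"] i by (simp add: D.act_E_X act_add_right act_smul)
  then have "smul (\<theta>s i - \<theta>s (Suc i)) (act (Es i) (w (Suc i))) = smul (\<phi> (Suc i)) (act (Es i) (w i))"
    by (simp add: V.scale_left_diff_distrib)
  then have "smul (1 / (\<theta>s i - \<theta>s (Suc i))) (smul (\<theta>s i - \<theta>s (Suc i)) (act (Es i) (w (Suc i))))
     = smul (1 / (\<theta>s i - \<theta>s (Suc i))) (smul (\<phi> (Suc i)) (act (Es i) (w i)))" by simp
  then show ?thesis using ne by simp
qed

lemma w_Suc_d: "w (Suc d) = 0"
  by (rule A.eq_by_components) (simp add: E_w)

end

section \<open>The split sequences under reversal\<close>

text \<open>\<open>- shift i\<close> is the ratio of the components of \<open>w i\<close> and \<open>w (i - 1)\<close> in \<open>Es (i - 1) V\<close>. It is set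
  to zero at 0 and \<open>d + 1\<close>, where \<open>w (-1)\<close> is absent and \<open>w (d + 1) = 0\<close>, so that the trace formula below
  is uniform in \<open>i\<close>.\<close>

definition shift :: "nat \<Rightarrow> 'k" where
  "shift i = (if i = 0 \<or> d < i then 0
     else first_split scale h A (Es 0) \<theta> \<theta>s i / (\<theta>s i - \<theta>s (i - 1)))"

text \<open>Take the component of \<open>A w i = \<theta> i w i + w (i + 1)\<close> in \<open>Es i V\<close>. On the left only the two highest
  components of \<open>w i\<close> contribute, as \<open>A\<close> is tridiagonal, and the contribution of the highest one is
  multiplication by the trace in question.\<close>

lemma trace_A_Es:
  assumes i: "i \<le> d"
  shows "tr h (A * Es i) = \<theta> i + shift i - shift (Suc i)"
proof -
  obtain v where v: "v \<noteq> 0" "act (Es 0) v = v" using D.range_nonzero[of 0] by auto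
  let ?w = "\<lambda>i. ev (tau \<theta> i) v"
  define e where "e = act (Es i) (?w i)"
  have e0: "e \<noteq> 0" unfolding e_def by (rule Es_w_diag[OF v i])
  have up: "act (Es i) (?w (Suc i)) = smul (- shift (Suc i)) e"
  proof (cases "Suc i \<le> d")
    case True
    then have "\<theta>s i \<noteq> \<theta>s (Suc i)" by (simp add: D.distinct)
    then show ?thesis using Es_w_sub[OF v True] True
      by (simp add: shift_def e_def minus_divide_right)
  next
    case False
    then have "Suc i = Suc d" using i by simp
    then show ?thesis by (simp only: w_Suc_d[OF v]) (simp add: shift_def)
  qed
  have down: "act (Es i) (act A (?w i)) = smul (tr h (A * Es i)) e - smul (shift i) e"
  proof -
    have diag: "act (Es i * A * Es i) (?w i) = smul (tr h (A * Es i)) e"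
      using i by (simp add: D.rank_one act_scale e_def)
    show ?thesis
    proof (cases i)
      case 0
      have "act (Es i) (act A (?w i)) = act (Es i * A * Es i) (?w i)"
        using v 0 by (simp add: w_0[OF v] act_mult)
      then show ?thesis using diag 0 by (simp add: shift_def)
    next
      case (Suc j)
      have j: "j \<le> d" "Suc j \<le> d" using i Suc by auto
      have "act (Es i) (act A (?w i)) = (\<Sum>k\<in>{i, j}. act (Es i * A * Es k) (?w i))"
        unfolding D.expand
      proof (rule sum.mono_neutral_right)
        show "\<forall>k\<in>{..d} - {i, j}. act (Es i * A * Es k) (?w i) = 0"
        proof
          fix k assume "k \<in> {..d} - {i, j}"
          then show "act (Es i * A * Es k) (?w i) = 0"
            using D.far[of i k] i Suc Es_w[OF v, of i k]
            by (cases "k < j"; cases "i < k") (auto simp: act_mult)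
        qed
      qed (use i Suc in auto)
      also have "\<dots> = smul (tr h (A * Es i)) e + act (Es i * A * Es j) (?w i)"
        using Suc diag by simp
      also have "act (Es i * A * Es j) (?w i) = smul (\<phi> i / (\<theta>s j - \<theta>s i)) (act (Es i * A * Es j) (?w j))"
        using Es_w_sub[OF v j(2)] Suc by (simp add: act_mult act_smul)
      also have "act (Es i * A * Es j) (?w j) = e"
        using D.raise[of j "?w j"] Es_w[OF v, of j] Es_w_Suc[OF v j(2)] j Suc by (simp add: e_def)
      also have "\<phi> i / (\<theta>s j - \<theta>s i) = - shift i"
        using Suc i by (simp add: shift_def minus_divide_right)
      finally show ?thesis by simp
    qed
  qed
  have "smul (\<theta> i) e + smul (- shift (Suc i)) e = smul (tr h (A * Es i)) e - smul (shift i) e"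
    using arg_cong[OF A_w[OF v, of i], of "act (Es i)"] up down
    by (simp add: act_add_right act_smul e_def)
  then have "smul (\<theta> i - shift (Suc i)) e = smul (tr h (A * Es i) - shift i) e"
    by (simp add: V.scale_left_diff_distrib)
  then have "\<theta> i - shift (Suc i) = tr h (A * Es i) - shift i"
    using e0 by (simp only: V.scale_cancel_right) simp
  then show ?thesis by (simp add: algebra_simps)
qed

lemma second_split_eq:
  "second_split scale h d A (Es 0) \<theta> \<theta>s = first_split scale h A (Es 0) (\<lambda>i. \<theta> (d - i)) \<theta>s"
  by (simp add: fun_eq_iff second_split_def first_split_def eta_def tau_def)

text \<open>The trace of \<open>A * Es i\<close>, computed in the system with the \<open>E\<close> reversed and in the system with the
  \<open>Es\<close> reversed, gives \<open>\<theta> (d - i)\<close> plus a difference of consecutive shifts in both cases. The shifts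
  of the first system are thus the negatives of those of the second, in opposite order; they agree at
  the start, where both are zero.\<close>

lemma second_split_reverse:
  assumes "1 \<le> i" "i \<le> d"
  shows "second_split scale h d A (Es 0) \<theta> \<theta>s i
    = first_split scale h A (Es d) \<theta> (\<lambda>i. \<theta>s (d - i)) (d + 1 - i)"
proof -
  interpret R: leonard_module scale act h d A "\<lambda>i. \<theta> (d - i)" "\<lambda>i. E (d - i)" As \<theta>s Es
    by (rule reverse_E)
  interpret L: leonard_module scale act h d A \<theta> E As "\<lambda>i. \<theta>s (d - i)" "\<lambda>i. Es (d - i)"
    by (rule reverse_Es)
  have rec: "R.shift k - R.shift (Suc k) = L.shift (d - k) - L.shift (Suc (d - k))" if "k \<le> d" for k
    using R.trace_A_Es[OF that] L.trace_A_Es[of "d - k"] that by simp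
  have "R.shift k = - L.shift (Suc d - k)" if "k \<le> d" for k
    using that
  proof (induction k)
    case (Suc k)
    then show ?case using rec[of k] by (simp add: Suc_diff_le algebra_simps) (metis minus_minus)
  qed (simp add: R.shift_def L.shift_def)
  from this[of i] have eq: "R.shift i = - L.shift (d + 1 - i)" using assms by simp
  have ne: "\<theta>s i \<noteq> \<theta>s (i - 1)" using assms by (simp add: D.distinct)
  have R: "R.shift i = second_split scale h d A (Es 0) \<theta> \<theta>s i / (\<theta>s i - \<theta>s (i - 1))"
    using assms by (simp add: R.shift_def second_split_eq)
  have idx: "d - (d + 1 - i) = i - 1" "d - (d + 1 - i - 1) = i" "\<not> d < d + 1 - i" "d + 1 - i \<noteq> 0"
    using assms by auto
  have L: "L.shift (d + 1 - i)
      = first_split scale h A (Es d) \<theta> (\<lambda>i. \<theta>s (d - i)) (d + 1 - i) / (\<theta>s (i - 1) - \<theta>s i)"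
    by (simp only: L.shift_def idx if_False simp_thms diff_zero)
  show ?thesis using eq ne unfolding R L by (simp add: minus_divide_right)
qed

section \<open>The switching element\<close>

definition switch_coeff :: "nat \<Rightarrow> 'k" where
  "switch_coeff r = (\<Prod>k<r. second_split scale h d A (Es 0) \<theta> \<theta>s (d - k))
      / (\<Prod>k=1..r. first_split scale h A (Es 0) \<theta> \<theta>s k)"

text \<open>Induction on \<open>r\<close>: the element \<open>E r * As * E (r + 1)\<close> maps the line \<open>E (r + 1) V\<close> into \<open>E r V\<close>, and
  \<open>superdiagonal\<close> computes it on \<open>E (r + 1) v\<close> and, in the reversed system, on \<open>E (r + 1) x\<close>. So the
  ratio of these two vectors follows from the ratio of \<open>E r x\<close> and \<open>E r v\<close>.\<close>

lemma E_component_ratio: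
  assumes v: "v \<noteq> 0" "act (Es 0) v = v" and x: "x \<noteq> 0" "act (Es d) x = x"
    and x0: "act (E 0) x = smul c (act (E 0) v)"
  shows "r \<le> d \<Longrightarrow> act (E r) x = smul (c * switch_coeff r) (act (E r) v)"
proof (induction r)
  case 0
  then show ?case using x0 by (simp add: switch_coeff_def)
next
  case (Suc r)
  interpret L: leonard_module scale act h d A \<theta> E As "\<lambda>i. \<theta>s (d - i)" "\<lambda>i. Es (d - i)"
    by (rule reverse_Es)
  have r: "Suc r \<le> d" "r \<le> d" using Suc.prems by auto
  have x': "act (Es (d - 0)) x = x" using x by simp
  let ?f = "first_split scale h A (Es 0) \<theta> \<theta>s"
  let ?g = "second_split scale h d A (Es 0) \<theta> \<theta>s"
  let ?p = "poly (tau \<theta> (Suc r)) (\<theta> (Suc r))" and ?q = "poly (tau \<theta> r) (\<theta> r)"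
  obtain u where u: "act (E (Suc r)) x = smul u (act (E (Suc r)) v)"
    using A.line[OF r(1) E_v[OF v r(1)]] by blast
  have g: "first_split scale h A (Es (d - 0)) \<theta> (\<lambda>i. \<theta>s (d - i)) (Suc r) = ?g (d - r)"
    using second_split_reverse[of "d - r"] r by simp
  have IH: "act (E r) x = smul (c * switch_coeff r) (act (E r) v)"
    using Suc.IH r by simp
  have "smul (u * (?f (Suc r) * ?q)) (act (E r) v) = smul u (smul ?p (act (E r * As * E (Suc r)) v))"
    by (simp only: superdiagonal[OF v r(1)] V.scale_scale)
  also have "\<dots> = smul ?p (act (E r * As * E (Suc r)) x)"
    by (simp add: act_mult u act_smul mult.commute)
  also have "\<dots> = smul (?g (d - r) * ?q) (act (E r) x)"
    using L.superdiagonal[OF x(1) x' r(1)] by (simp only: g)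
  also have "\<dots> = smul (?g (d - r) * ?q * (c * switch_coeff r)) (act (E r) v)"
    by (simp add: IH)
  finally have "u * (?f (Suc r) * ?q) = ?g (d - r) * ?q * (c * switch_coeff r)"
    using E_v[OF v r(2)] by (simp add: V.scale_cancel_right)
  then have "u * ?f (Suc r) = c * (switch_coeff r * ?g (d - r))"
    using poly_tau_neq_0[OF r(2)] by (simp add: mult_ac)
  then have "u = c * (switch_coeff r * ?g (d - r) / ?f (Suc r))"
    using split(2)[OF v r(1)] by (simp add: divide_simps mult_ac)
  also have "switch_coeff r * ?g (d - r) / ?f (Suc r) = switch_coeff (Suc r)"
    by (simp add: switch_coeff_def)
  finally show ?case using u by simp
qed

lemma poly_eval_spectral: "poly_eval scale p A = (\<Sum>r\<le>d. scale (poly p (\<theta> r)) (E r))"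
proof (rule A.faithful, rule A.eq_by_components)
  fix v i assume i: "i \<le> d"
  have "act (E i) (act (\<Sum>r\<le>d. scale (poly p (\<theta> r)) (E r)) v)
      = (\<Sum>r\<le>d. if r = i then smul (poly p (\<theta> i)) (act (E i) v) else 0)"
    unfolding act_sum_left act_sum_right
    by (rule sum.cong) (auto simp: act_scale act_smul A.act_E_E i)
  then show "act (E i) (ev p v) = act (E i) (act (\<Sum>r\<le>d. scale (poly p (\<theta> r)) (E r)) v)"
    using i by (simp add: A.act_E_poly)
qed

text \<open>Here \<open>p(A) v\<close> is a nonzero vector of the line \<open>Es d V\<close>, so the ratios in \<open>E_component_ratio\<close>
  apply to it.\<close>

lemma leonard_poly_values:
  assumes p: "is_leonard_poly scale act A Es d p"
  shows "poly p (\<theta> 0) \<noteq> 0" and "r \<le> d \<Longrightarrow> poly p (\<theta> r) = poly p (\<theta> 0) * switch_coeff r"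
proof -
  have img: "ev p ` range (act (Es 0)) = range (act (Es d))"
    using p by (simp add: is_leonard_poly_def)
  obtain v where v: "v \<noteq> 0" "act (Es 0) v = v" using D.range_nonzero[of 0] by auto
  define x where "x = ev p v"
  have "x \<in> ev p ` range (act (Es 0))" unfolding x_def by (metis v(2) imageI rangeI)
  then obtain u where "x = act (Es d) u" unfolding img by blast
  then have x_fix: "act (Es d) x = x" by (simp add: D.act_E_E)
  have x0: "x \<noteq> 0"
  proof
    assume "x = 0"
    obtain y where y: "y \<noteq> 0" "act (Es d) y = y" using D.range_nonzero[of d] by auto
    then have "y \<in> ev p ` range (act (Es 0))" unfolding img by (metis rangeI)
    then obtain u where u: "y = ev p (act (Es 0) u)" by blast
    obtain c where "act (Es 0) u = smul c v" using D.line[of 0 v u] v by auto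
    then have "y = smul c x" by (simp add: u act_smul x_def)
    then show False using \<open>x = 0\<close> y by simp
  qed
  have comp: "act (E i) x = smul (poly p (\<theta> i)) (act (E i) v)" if "i \<le> d" for i
    using that by (simp add: x_def A.act_E_poly)
  have ratio: "act (E i) x = smul (poly p (\<theta> 0) * switch_coeff i) (act (E i) v)" if "i \<le> d" for i
    by (rule E_component_ratio[OF v x0 x_fix comp that]) simp
  show "poly p (\<theta> 0) \<noteq> 0"
  proof
    assume "poly p (\<theta> 0) = 0"
    then have "x = 0" using ratio by (intro A.eq_0_by_components[of x]) simp
    then show False using x0 by simp
  qed
  show "poly p (\<theta> r) = poly p (\<theta> 0) * switch_coeff r" if r: "r \<le> d"
    using comp[OF r] ratio[OF r] E_v[OF v r] V.scale_cancel_right by metis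
qed

text \<open>The vector \<open>\<tau>\<^sub>d(A) v\<close> has a nonzero component in \<open>Es d V\<close>, and its other components can be removed
  by a polynomial of lower degree.\<close>

lemma leonard_poly_exists: "\<exists>p. is_leonard_poly scale act A Es d p"
proof -
  obtain v where v: "v \<noteq> 0" "act (Es 0) v = v" using D.range_nonzero[of 0] by auto
  define e where "e = act (Es d) (ev (tau \<theta> d) v)"
  have "\<exists>q. (q = 0 \<or> degree q < d) \<and> ev (tau \<theta> d) v - e = ev q v"
  proof (rule cyclic[OF v])
    show "act (Es j) (ev (tau \<theta> d) v - e) = 0" if "d \<le> j" "j \<le> d" for j
      using that by (simp add: e_def act_diff_right D.act_E_E)
  qed simp
  then obtain q where q: "q = 0 \<or> degree q < d" "ev (tau \<theta> d) v - e = ev q v" by blast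
  define p where "p = tau \<theta> d - q"
  have coeff: "coeff q d = 0" using q(1) by (auto simp: coeff_eq_0)
  have lead: "coeff p d = 1"
    using lead_coeff_tau[of d] coeff by (simp add: p_def degree_tau)
  have "degree p \<le> d"
    unfolding p_def using q(1) by (intro degree_diff_le) (auto simp: degree_tau)
  moreover have "d \<le> degree p" using lead by (intro le_degree) simp
  ultimately have deg: "degree p = d" by simp
  have ev_p: "ev p v = e" using q(2) by (simp add: p_def ev_diff algebra_simps)
  have "ev p ` range (act (Es 0)) = range (act (Es d))"
  proof (intro equalityI subsetI)
    fix y assume "y \<in> ev p ` range (act (Es 0))"
    then obtain u where u: "y = ev p (act (Es 0) u)" by blast
    obtain c where "act (Es 0) u = smul c v" using D.line[of 0 v u] v by auto
    then have "y = act (Es d) (smul c (ev (tau \<theta> d) v))"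
      by (simp add: u act_smul ev_p e_def)
    then show "y \<in> range (act (Es d))" by blast
  next
    fix y assume "y \<in> range (act (Es d))"
    then obtain u where u: "y = act (Es d) u" by blast
    obtain c where "y = smul c e"
      using D.line[OF _ Es_w_diag[OF v], of d u] by (auto simp: u e_def)
    then have "y = ev p (act (Es 0) (smul c v))" by (simp add: act_smul v ev_p)
    then show "y \<in> ev p ` range (act (Es 0))" by blast
  qed
  then show ?thesis using deg lead by (auto simp: is_leonard_poly_def)
qed

text \<open>Up to a scalar, the values at the \<open>d + 1\<close> eigenvalues are prescribed by \<open>leonard_poly_values\<close>;
  being monic fixes the scalar.\<close>

lemma leonard_poly_unique:
  assumes p: "is_leonard_poly scale act A Es d p" and q: "is_leonard_poly scale act A Es d q"
  shows "p = q"
proof -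
  have deg: "degree p = d" "degree q = d" and lead: "coeff p d = 1" "coeff q d = 1"
    using p q by (auto simp: is_leonard_poly_def)
  define a where "a = poly p (\<theta> 0)"
  define b where "b = poly q (\<theta> 0)"
  define f where "f = Polynomial.smult b p - Polynomial.smult a q"
  have "f = 0"
  proof (rule ccontr)
    assume f0: "f \<noteq> 0"
    have "poly f (\<theta> r) = 0" if "r \<le> d" for r
      using leonard_poly_values(2)[OF p that] leonard_poly_values(2)[OF q that]
      by (simp add: f_def a_def b_def)
    then have "card (\<theta> ` {..d}) \<le> card {t. poly f t = 0}"
      by (intro card_mono poly_roots_finite[OF f0]) auto
    moreover have "card {t. poly f t = 0} \<le> degree f" by (rule card_poly_roots_bound[OF f0])
    moreover have "degree f \<le> d"
      unfolding f_def using deg by (intro degree_diff_le order_trans[OF degree_smult_le]) auto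
    ultimately show False using card_image[OF A.inj] by simp
  qed
  then have "coeff f d = 0" by simp
  then have "b = a" using lead by (simp add: f_def)
  then have "Polynomial.smult a (p - q) = 0" using \<open>f = 0\<close> by (simp add: f_def smult_diff_right)
  then show "p = q" using leonard_poly_values(1)[OF p] by (simp add: a_def)
qed

lemma switching_element_eq:
  assumes p: "is_leonard_poly scale act A Es d p"
  shows "switching_element scale h d A E (Es 0) \<theta> \<theta>s
    = poly_eval scale (Polynomial.smult (1 / poly p (\<theta> 0)) p) A"
proof -
  have "poly (Polynomial.smult (1 / poly p (\<theta> 0)) p) (\<theta> r) = switch_coeff r" if "r \<le> d" for r
    using leonard_poly_values(2)[OF p that] leonard_poly_values(1)[OF p] by simp
  then show ?thesis
    unfolding poly_eval_spectral switching_element_def switch_coeff_def[symmetric]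
    by (intro sum.cong) auto
qed

end

section \<open>Diagonalization in the matrix algebra\<close>

context matrix_algebra_iso
begin

definition ent :: "'a \<Rightarrow> nat \<Rightarrow> nat \<Rightarrow> 'k" where
  "ent X i j = h X $$ (i, j)"

lemma h_carrier: "h X \<in> carrier_mat (d + 1) (d + 1)"
  using h_bij by (auto simp: bij_betw_def)

lemma h_dim [simp]: "dim_row (h X) = Suc d" "dim_col (h X) = Suc d"
  using h_carrier[of X] by auto

lemma ent_add: "i \<le> d \<Longrightarrow> j \<le> d \<Longrightarrow> ent (X + Y) i j = ent X i j + ent Y i j"
  by (simp add: ent_def h_add)

lemma ent_scale: "i \<le> d \<Longrightarrow> j \<le> d \<Longrightarrow> ent (scale c X) i j = c * ent X i j"
  by (simp add: ent_def h_scale)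

lemma ent_one: "i \<le> d \<Longrightarrow> j \<le> d \<Longrightarrow> ent 1 i j = (if i = j then 1 else 0)"
  by (simp add: ent_def h_one)

lemma ent_mult:
  "i \<le> d \<Longrightarrow> j \<le> d \<Longrightarrow> ent (X * Y) i j = (\<Sum>k\<le>d. ent X i k * ent Y k j)"
  by (simp add: ent_def h_mult scalar_prod_def atLeast0LessThan lessThan_Suc_atMost del: sum.lessThan_Suc)

lemma mult_mat_vec_index:
  assumes "v \<in> carrier_vec (Suc d)" "i \<le> d"
  shows "(h X *\<^sub>v v) $ i = (\<Sum>k\<le>d. ent X i k * v $ k)"
  using assms
  by (simp add: scalar_prod_def ent_def atLeast0LessThan lessThan_Suc_atMost del: sum.lessThan_Suc)

lemma ent_eqI:
  assumes "\<And>i j. i \<le> d \<Longrightarrow> j \<le> d \<Longrightarrow> ent X i j = ent Y i j" shows "X = Y"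
proof -
  have "h X = h Y" by (rule eq_matI) (use assms in \<open>auto simp: ent_def\<close>)
  then show ?thesis using h_bij by (auto simp: bij_betw_def inj_on_def)
qed

lemma ent_zero: "i \<le> d \<Longrightarrow> j \<le> d \<Longrightarrow> ent 0 i j = 0"
  using ent_scale[of i j 0 0] by simp

lemma ent_diff: "i \<le> d \<Longrightarrow> j \<le> d \<Longrightarrow> ent (X - Y) i j = ent X i j - ent Y i j"
  using ent_add[of i j "X - Y" Y] by simp

lemma ent_sum: "i \<le> d \<Longrightarrow> j \<le> d \<Longrightarrow> ent (sum f I) i j = (\<Sum>k\<in>I. ent (f k) i j)"
  by (induction I rule: infinite_finite_induct) (auto simp: ent_add ent_zero)

definition of_entries :: "(nat \<Rightarrow> nat \<Rightarrow> 'k) \<Rightarrow> 'a" where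
  "of_entries f = inv_into UNIV h (mat (d + 1) (d + 1) (\<lambda>(i, j). f i j))"

lemma h_of_entries: "h (of_entries f) = mat (d + 1) (d + 1) (\<lambda>(i, j). f i j)"
proof -
  have "mat (d + 1) (d + 1) (\<lambda>(i, j). f i j) \<in> range h"
    using h_bij by (auto simp: bij_betw_def)
  then show ?thesis unfolding of_entries_def by (rule f_inv_into_f)
qed

lemma ent_of_entries: "i \<le> d \<Longrightarrow> j \<le> d \<Longrightarrow> ent (of_entries f) i j = f i j"
  by (simp add: ent_def h_of_entries)

lemma tr_eq: "tr h X = (\<Sum>i\<le>d. ent X i i)"
  by (simp add: tr_def ent_def lessThan_Suc_atMost del: sum.lessThan_Suc)

lemma tr_commute: "tr h (X * Y) = tr h (Y * X)"
proof -
  have "tr h (X * Y) = (\<Sum>i\<le>d. \<Sum>k\<le>d. ent X i k * ent Y k i)"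
    by (simp add: tr_eq ent_mult)
  also have "\<dots> = (\<Sum>k\<le>d. \<Sum>i\<le>d. ent X i k * ent Y k i)" by (rule sum.swap)
  also have "\<dots> = tr h (Y * X)" by (simp add: tr_eq ent_mult mult.commute)
  finally show ?thesis .
qed

text \<open>A matrix unit \<open>Y\<close> placed between a nonzero column of \<open>X\<close> and a nonzero row of \<open>Z\<close>.\<close>

lemma prime_matrix_algebra:
  fixes X Z :: 'a
  assumes "X \<noteq> 0" "Z \<noteq> 0" shows "\<exists>Y. X * Y * Z \<noteq> 0"
proof -
  obtain i j where ij: "i \<le> d" "j \<le> d" "ent X i j \<noteq> 0"
    using ent_eqI[of X 0] assms(1) ent_zero by metis
  obtain k l where kl: "k \<le> d" "l \<le> d" "ent Z k l \<noteq> 0"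
    using ent_eqI[of Z 0] assms(2) ent_zero by metis
  define Y where "Y = of_entries (\<lambda>a b. if a = j \<and> b = k then 1 else 0)"
  have XY: "ent (X * Y) i b = (if b = k then ent X i j else 0)" if "b \<le> d" for b
  proof -
    have "ent (X * Y) i b = (\<Sum>a\<le>d. if a = j then (if b = k then ent X i j else 0) else 0)"
      unfolding ent_mult[OF ij(1) that]
      by (rule sum.cong) (use that in \<open>auto simp: Y_def ent_of_entries\<close>)
    then show ?thesis using ij by simp
  qed
  have "ent (X * Y * Z) i l = (\<Sum>b\<le>d. if b = k then ent X i j * ent Z k l else 0)"
    unfolding ent_mult[OF ij(1) kl(2)] by (rule sum.cong) (auto simp: XY)
  then have "ent (X * Y * Z) i l \<noteq> 0" using ij kl by simp
  then show ?thesis using ent_zero[OF ij(1) kl(2)] by metis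
qed

definition diag :: "(nat \<Rightarrow> 'k) \<Rightarrow> 'a" where
  "diag f = of_entries (\<lambda>i j. if i = j then f i else 0)"

lemma ent_diag: "i \<le> d \<Longrightarrow> j \<le> d \<Longrightarrow> ent (diag f) i j = (if i = j then f i else 0)"
  by (simp add: diag_def ent_of_entries)

lemma diag_cong: "(\<And>i. i \<le> d \<Longrightarrow> f i = g i) \<Longrightarrow> diag f = diag g"
  by (rule ent_eqI) (simp add: ent_diag)

lemma ent_mult_diag: "i \<le> d \<Longrightarrow> j \<le> d \<Longrightarrow> ent (X * diag f) i j = ent X i j * f j"
proof -
  assume ij: "i \<le> d" "j \<le> d"
  have "ent (X * diag f) i j = (\<Sum>k\<le>d. if k = j then ent X i j * f j else 0)"
    unfolding ent_mult[OF ij] by (rule sum.cong) (auto simp: ent_diag ij)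
  then show ?thesis using ij by simp
qed

lemma ent_diag_mult: "i \<le> d \<Longrightarrow> j \<le> d \<Longrightarrow> ent (diag f * X) i j = f i * ent X i j"
proof -
  assume ij: "i \<le> d" "j \<le> d"
  have "ent (diag f * X) i j = (\<Sum>k\<le>d. if k = i then f i * ent X i j else 0)"
    unfolding ent_mult[OF ij] by (rule sum.cong) (auto simp: ent_diag ij)
  then show ?thesis using ij by simp
qed

lemma diag_mult: "diag f * diag g = diag (\<lambda>i. f i * g i)"
  by (rule ent_eqI) (simp add: ent_mult_diag ent_diag)

lemma diag_one: "diag (\<lambda>i. 1) = 1"
  by (rule ent_eqI) (simp add: ent_diag ent_one)

lemma scale_diag: "scale c (diag f) = diag (\<lambda>i. c * f i)"
  by (rule ent_eqI) (simp add: ent_diag ent_scale)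

lemma diag_diff: "diag f - diag g = diag (\<lambda>i. f i - g i)"
  by (rule ent_eqI) (simp add: ent_diag ent_diff)

abbreviation "unit_diag i \<equiv> diag (\<lambda>k. if k = i then 1 else 0)"

lemma sum_unit_diag: "(\<Sum>i\<le>d. scale (f i) (unit_diag i)) = diag f"
proof (rule ent_eqI)
  fix a b assume ab: "a \<le> d" "b \<le> d"
  have "ent (\<Sum>i\<le>d. scale (f i) (unit_diag i)) a b = (\<Sum>i\<le>d. if i = a then (if a = b then f a else 0) else 0)"
    unfolding ent_sum[OF ab] by (rule sum.cong) (auto simp: ent_scale ent_diag ab)
  then show "ent (\<Sum>i\<le>d. scale (f i) (unit_diag i)) a b = ent (diag f) a b"
    using ab by (simp add: ent_diag)
qed

lemma unit_diag_corner:
  assumes "i \<le> d" shows "unit_diag i * Y * unit_diag i = scale (ent Y i i) (unit_diag i)"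
  by (rule ent_eqI) (auto simp: ent_mult_diag ent_diag_mult ent_scale ent_diag assms)

lemma tr_mult_unit_diag:
  assumes "i \<le> d" shows "tr h (Y * unit_diag i) = ent Y i i"
proof -
  have "tr h (Y * unit_diag i) = (\<Sum>k\<le>d. if k = i then ent Y i i else 0)"
    unfolding tr_eq by (rule sum.cong) (auto simp: ent_mult_diag)
  then show ?thesis using assms by simp
qed

context
  fixes X :: 'a and \<theta> :: "nat \<Rightarrow> 'k" and E :: "nat \<Rightarrow> 'a"
  assumes orderings: "associated_orderings scale h d X \<theta> E"
begin

lemma eigenvalues_inj: "inj_on \<theta> {..d}"
  using orderings by (auto simp: associated_orderings_def bij_betw_def)

lemma eigenvector_matrix:
  "\<exists>P. X * P = P * diag \<theta> \<and> (\<forall>j\<le>d. \<exists>i\<le>d. ent P i j \<noteq> 0)"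
proof -
  have "\<exists>v. v \<in> carrier_vec (Suc d) \<and> v \<noteq> 0\<^sub>v (Suc d) \<and> h X *\<^sub>v v = \<theta> j \<cdot>\<^sub>v v" if "j \<le> d" for j
  proof -
    have "\<theta> j \<in> eigenvalues h X"
      using orderings that by (auto simp: associated_orderings_def bij_betw_def)
    then show ?thesis
      unfolding eigenvalues_def eigenvalue_def eigenvector_def by simp
  qed
  then obtain e where e: "\<And>j. j \<le> d \<Longrightarrow> e j \<in> carrier_vec (Suc d) \<and> e j \<noteq> 0\<^sub>v (Suc d)
      \<and> h X *\<^sub>v e j = \<theta> j \<cdot>\<^sub>v e j" by metis
  define P where "P = of_entries (\<lambda>i j. e j $ i)"
  have "X * P = P * diag \<theta>"
  proof (rule ent_eqI)
    fix i j assume ij: "i \<le> d" "j \<le> d"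
    have "ent (X * P) i j = (\<Sum>k\<le>d. ent X i k * e j $ k)"
      unfolding ent_mult[OF ij] by (rule sum.cong) (auto simp: P_def ent_of_entries ij)
    also have "\<dots> = (h X *\<^sub>v e j) $ i"
      by (rule mult_mat_vec_index[symmetric]) (use e[OF ij(2)] ij in auto)
    also have "\<dots> = (\<theta> j \<cdot>\<^sub>v e j) $ i" using e[OF ij(2)] by simp
    also have "(\<theta> j \<cdot>\<^sub>v e j) $ i = \<theta> j * e j $ i"
    proof -
      have "dim_vec (e j) = Suc d" using e[OF ij(2)] by (blast dest: carrier_vecD)
      then show ?thesis using ij(1) by simp
    qed
    finally show "ent (X * P) i j = ent (P * diag \<theta>) i j"
      using ij by (simp add: ent_mult_diag P_def ent_of_entries)
  qed
  moreover have "\<exists>i\<le>d. ent P i j \<noteq> 0" if j: "j \<le> d" for j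
  proof (rule ccontr)
    assume "\<not> ?thesis"
    then have "e j = 0\<^sub>v (Suc d)"
      using e[OF j] j by (intro eq_vecI) (auto simp: P_def ent_of_entries carrier_vecD)
    then show False using e[OF j] by blast
  qed
  ultimately show ?thesis by blast
qed

text \<open>The columns of \<open>P\<close> are eigenvectors of \<open>X\<close>, so each factor of the product that defines \<open>E i\<close> scales
  them, and the product acts on them by the values of a Lagrange basis polynomial.\<close>

lemma idempotent_eigenvectors:
  assumes P: "X * P = P * diag \<theta>" and i: "i \<le> d"
  shows "E i * P = P * unit_diag i"
proof -
  define F where "F j = scale (1 / (\<theta> i - \<theta> j)) (X - scale (\<theta> j) 1)" for j
  define g where "g j b = (\<theta> b - \<theta> j) / (\<theta> i - \<theta> j)" for j b
  have F: "F j * P = P * diag (g j)" for j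
  proof -
    have "F j * P = scale (1 / (\<theta> i - \<theta> j)) (X * P - scale (\<theta> j) P)"
      by (simp add: F_def scale_mult_left left_diff_distrib)
    also have "\<dots> = P * scale (1 / (\<theta> i - \<theta> j)) (diag \<theta> - scale (\<theta> j) 1)"
      by (simp add: P scale_mult_right right_diff_distrib)
    also have "diag \<theta> - scale (\<theta> j) 1 = diag (\<lambda>b. \<theta> b - \<theta> j)"
      by (simp add: scale_diag diag_diff flip: diag_one)
    finally show ?thesis by (simp add: scale_diag g_def[abs_def])
  qed
  have prod: "prod_list (map F js) * P = P * diag (\<lambda>b. prod_list (map (\<lambda>j. g j b) js))" for js
  proof (induction js)
    case Nil
    then show ?case by (simp add: diag_one)
  next
    case (Cons j js)
    have "prod_list (map F (j # js)) * P = F j * (prod_list (map F js) * P)" by (simp add: mult.assoc)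
    also have "\<dots> = F j * P * diag (\<lambda>b. prod_list (map (\<lambda>j. g j b) js))"
      by (simp add: Cons.IH mult.assoc)
    also have "\<dots> = P * diag (\<lambda>b. prod_list (map (\<lambda>j. g j b) (j # js)))"
      by (simp add: F mult.assoc diag_mult)
    finally show ?case .
  qed
  define js where "js = filter (\<lambda>j. j \<noteq> i) [0..<d + 1]"
  have js: "j \<in> set js \<longleftrightarrow> j \<le> d \<and> j \<noteq> i" for j by (auto simp: js_def)
  have "E i = prod_list (map F js)"
    using orderings i by (simp add: associated_orderings_def primitive_idempotent_def F_def[abs_def] js_def)
  then have "E i * P = P * diag (\<lambda>b. prod_list (map (\<lambda>j. g j b) js))" by (simp only: prod)
  also have "diag (\<lambda>b. prod_list (map (\<lambda>j. g j b) js)) = unit_diag i"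
  proof (rule diag_cong)
    fix b assume b: "b \<le> d"
    show "prod_list (map (\<lambda>j. g j b) js) = (if b = i then 1 else 0)"
    proof (cases "b = i")
      case True
      have "g j i = 1" if "j \<in> set js" for j
        using that i inj_on_eq_iff[OF eigenvalues_inj, of i j] by (auto simp: g_def js)
      then have "map (\<lambda>j. g j b) js = map (\<lambda>j. 1) js" using True by simp
      then show ?thesis using True by (simp add: map_replicate_const prod_list_replicate)
    next
      case False
      then have "g b b \<in> set (map (\<lambda>j. g j b) js)" using b by (simp add: js)
      then have "prod_list (map (\<lambda>j. g j b) js) = 0" by (simp add: prod_list_zero_iff g_def)
      then show ?thesis using False by simp
    qed
  qed
  finally show ?thesis .
qed

text \<open>The matrix \<open>P\<close> of eigenvectors is invertible: applying \<open>E i\<close> to a linear relation between its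
  columns isolates the \<open>i\<close>-th summand.\<close>

lemma diagonalization:
  "\<exists>P Q. P * Q = 1 \<and> Q * P = 1 \<and> X = P * diag \<theta> * Q \<and> (\<forall>i\<le>d. E i = P * unit_diag i * Q)"
proof -
  obtain P where P: "X * P = P * diag \<theta>" and cols: "\<And>j. j \<le> d \<Longrightarrow> \<exists>i\<le>d. ent P i j \<noteq> 0"
    using eigenvector_matrix by blast
  have "det (h P) \<noteq> 0"
  proof
    assume "det (h P) = 0"
    then obtain v where v: "v \<in> carrier_vec (d + 1)" "v \<noteq> 0\<^sub>v (d + 1)" "h P *\<^sub>v v = 0\<^sub>v (d + 1)"
      using det_0_iff_vec_prod_zero_field[OF h_carrier[of P]] by blast
    have "v $ i = 0" if i: "i \<le> d" for i
    proof -
      obtain a where a: "a \<le> d" "ent P a i \<noteq> 0" using cols[OF i] by blast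
      have "h (P * unit_diag i) *\<^sub>v v = h (E i) *\<^sub>v (h P *\<^sub>v v)"
        by (simp add: idempotent_eigenvectors[OF P i, symmetric] h_mult
            assoc_mult_mat_vec[OF h_carrier h_carrier v(1)])
      also have "\<dots> = 0\<^sub>v (d + 1)" unfolding v(3) using h_carrier[of "E i"]
        by (intro eq_vecI) auto
      finally have "(h (P * unit_diag i) *\<^sub>v v) $ a = 0" using a by simp
      moreover have "(h (P * unit_diag i) *\<^sub>v v) $ a = (\<Sum>k\<le>d. ent (P * unit_diag i) a k * v $ k)"
        by (rule mult_mat_vec_index) (use a v in simp_all)
      moreover have "\<dots> = (\<Sum>k\<le>d. if k = i then ent P a i * v $ i else 0)"
        by (rule sum.cong) (auto simp: ent_mult_diag a)
      ultimately show ?thesis using a i by simp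
    qed
    then have "v = 0\<^sub>v (d + 1)" using v(1) by (intro eq_vecI) auto
    then show False using v(2) by simp
  qed
  then obtain B where B: "B \<in> carrier_mat (d + 1) (d + 1)" "B * h P = 1\<^sub>m (d + 1)" "h P * B = 1\<^sub>m (d + 1)"
    using det_non_zero_imp_unit[OF h_carrier[of P]] by (auto simp: Units_def ring_mat_def)
  have "B \<in> range h" using B(1) h_bij by (simp add: bij_betw_def)
  then obtain Q where Q: "h Q = B" by blast
  have h_eq: "h Y = h Z \<Longrightarrow> Y = Z" for Y Z using h_bij by (auto simp: bij_betw_def inj_on_def)
  have PQ: "P * Q = 1" "Q * P = 1" by (rule h_eq; simp add: h_mult h_one Q B)+
  have cancel: "Y * P * Q = Y" for Y by (simp only: mult.assoc PQ mult_1_right)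
  have "X = P * diag \<theta> * Q" using cancel[of X] by (simp only: P)
  moreover have "E i = P * unit_diag i * Q" if "i \<le> d" for i
    using cancel[of "E i"] by (simp only: idempotent_eigenvectors[OF P that])
  ultimately show ?thesis using PQ by blast
qed

text \<open>After conjugation with \<open>P\<close> the idempotents are diagonal matrix units, for which all claims are
  entrywise.\<close>

lemma module_resolution:
  assumes "algebra_module scale act"
  shows "module_resolution scale act (tr h) d X \<theta> E"
proof -
  obtain P Q where PQ: "P * Q = 1" "Q * P = 1" and X: "X = P * diag \<theta> * Q"
    and E: "\<And>i. i \<le> d \<Longrightarrow> E i = P * unit_diag i * Q"
    using diagonalization by blast
  have conj: "P * Y * Q * (P * Z * Q) = P * (Y * Z) * Q" for Y Z
    using PQ(2) by (simp add: mult.assoc flip: mult.assoc[of Q P])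
  have E_sum: "(\<Sum>i\<le>d. scale (f i) (E i)) = P * diag f * Q" for f
  proof -
    have "(\<Sum>i\<le>d. scale (f i) (E i)) = (\<Sum>i\<le>d. P * scale (f i) (unit_diag i) * Q)"
      by (rule sum.cong) (simp_all add: E scale_mult_left scale_mult_right)
    also have "\<dots> = P * (\<Sum>i\<le>d. scale (f i) (unit_diag i)) * Q"
      by (simp add: sum_distrib_left sum_distrib_right)
    finally show ?thesis by (simp only: sum_unit_diag)
  qed
  show ?thesis
  proof (intro module_resolution.intro module_resolution_axioms.intro assms eigenvalues_inj)
    show "(\<Sum>i\<le>d. E i) = 1" using E_sum[of "\<lambda>i. 1"] by (simp add: diag_one PQ)
    show "X = (\<Sum>i\<le>d. scale (\<theta> i) (E i))" by (simp add: E_sum X)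
    fix i assume i: "i \<le> d"
    show "E i \<noteq> 0"
    proof
      assume "E i = 0"
      have "unit_diag i = Q * P * unit_diag i * (Q * P)" by (simp add: PQ)
      also have "\<dots> = Q * E i * P" by (simp add: E i mult.assoc)
      finally have "ent (unit_diag i) i i = ent 0 i i" using \<open>E i = 0\<close> by simp
      then show False using i by (simp add: ent_diag ent_zero)
    qed
    show "E i * E j = (if i = j then E i else 0)" if "j \<le> d" for j
    proof -
      have "E i * E j = P * (unit_diag i * unit_diag j) * Q" by (simp only: E i that conj)
      also have "unit_diag i * unit_diag j = (if i = j then unit_diag i else 0)"
        by (rule ent_eqI) (auto simp: diag_mult ent_diag ent_zero)
      also have "P * (if i = j then unit_diag i else 0) * Q = (if i = j then E i else 0)"
        using E[OF i] by auto
      finally show ?thesis .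
    qed
    show "E i * Y * E i = scale (tr h (Y * E i)) (E i)" for Y
    proof -
      have "E i * Y * E i = P * (unit_diag i * (Q * Y * P) * unit_diag i) * Q"
        by (simp add: E i mult.assoc)
      also have "\<dots> = scale (ent (Q * Y * P) i i) (E i)"
        by (simp only: unit_diag_corner[OF i] scale_mult_left scale_mult_right E[OF i])
      also have "ent (Q * Y * P) i i = tr h (Q * (Y * (P * unit_diag i)))"
        by (simp add: mult.assoc flip: tr_mult_unit_diag[OF i])
      also have "\<dots> = tr h (Y * E i)"
        by (subst tr_commute) (simp add: E i mult.assoc)
      finally show ?thesis .
    qed
  qed
qed

end

end

section \<open>The switching element as a polynomial in \<open>A\<close>\<close>

lemma leonard_module_of_leonard_system:
  assumes "matrix_algebra_iso scale d h" and "simple_left_module act"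
    and L: "leonard_system scale h d A E As Es"
    and A: "associated_orderings scale h d A \<theta> E"
    and As: "associated_orderings scale h d As \<theta>s Es"
  shows "leonard_module scale act h d A \<theta> E As \<theta>s Es"
proof -
  interpret matrix_algebra_iso scale d h by fact
  interpret simple_left_module act by fact
  have M: "algebra_module scale act"
    by (intro algebra_module.intro field_algebra_axioms simple_left_module_axioms
        algebra_module_axioms.intro prime_matrix_algebra)
  show ?thesis
    using L unfolding leonard_system_def
    by (intro leonard_module.intro tridiagonal_resolution.intro tridiagonal_resolution_axioms.intro
        module_resolution A As M) auto
qed

theorem theorem6p6:
  fixes scale :: "'k::field \<Rightarrow> 'a::ring_1 \<Rightarrow> 'a"
    and act :: "'a \<Rightarrow> 'v::ab_group_add \<Rightarrow> 'v"
    and h :: "'a \<Rightarrow> 'k mat" and d :: nat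
    and A As :: 'a and E Es :: "nat \<Rightarrow> 'a"
    and \<theta> \<theta>s :: "nat \<Rightarrow> 'k"
  assumes "matrix_algebra_iso scale d h"
    and "simple_left_module act"
    and "leonard_system scale h d A E As Es"
    and "associated_orderings scale h d A \<theta> E"
    and "associated_orderings scale h d As \<theta>s Es"
  shows "(\<exists>!p. is_leonard_poly scale act A Es d p) \<and>
         (\<forall>p. is_leonard_poly scale act A Es d p \<longrightarrow>
           poly p (\<theta> 0) \<noteq> 0 \<and>
           switching_element scale h d A E (Es 0) \<theta> \<theta>s
             = poly_eval scale (Polynomial.smult (1 / poly p (\<theta> 0)) p) A)"
proof -
  interpret leonard_module scale act h d A \<theta> E As \<theta>s Es
    by (rule leonard_module_of_leonard_system[OF assms])
  show ?thesis
    by (intro conjI ex_ex1I allI impI)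
      (rule leonard_poly_exists leonard_poly_unique leonard_poly_values(1) switching_element_eq; assumption)+
qed

end
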